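(* Let $P=(\varphi_n)_{n=0}^\infty$ be a fixed sequence of functions as in the context. Let $x_0\in(0,1]$, let $(x_n)_{n=1}^\infty$ be a sequence of numbers from $(0,1]\setminus\{x_0\}$, and for each $n\in\mathbb{N}$ let $k_n$ be the minimum number $j\in\mathbb{N}$ such that $p_j(x_n)\neq p_j(x_0)$. If $x_0$ is not an endpoint (infimum or supremum) of any $P$-cylinder, then $$\lim_{n\to\infty}x_n=x_0\iff\lim_{n\to\infty}k_n=\infty.$$
   Context: $\mathbb{N}=\{1,2,3,\ldots\}$. Fix a sequence $P=(\varphi_n)_{n=0}^\infty$, where $\varphi_0\in\mathbb{N}$ is a constant and, for $n\ge 1$, $\varphi_n\colon\mathbb{N}^n\to\mathbb{N}$ is an arbitrary function. The $P$-representation (positive Perron expansion) of $x\in(0,1]$ is the expansion $$x=\sum_{n=0}^{\infty}\frac{r_0 r_1\cdots r_n}{(p_1-1)p_1\cdots(p_n-1)p_n\,p_{n+1}},$$ where $p_1,p_2,\ldots\in\mathbb{N}$, $r_0=\varphi_0$, $r_n=\varphi_n(p_1,\ldots,p_n)$ and $p_n\ge r_{n-1}+1$ for all $n\in\mathbb{N}$ (the $n=0$ term is $r_0/p_1$). It is known that for every such $P$ each $x\in(0,1]$ has a unique $P$-representation; the number $p_n=p_n(x)$ is called the $n$th $P$-digit of $x$. For $k\ge 1$, the $P$-cylinder of rank $k$ with base $c_1\ldots c_k$ is the set $\Delta^P_{c_1\ldots c_k}$ of all $x\in(0,1]$ with $p_1(x)=c_1,\ldots,p_k(x)=c_k$;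 here the base is admissible, i.e. $c_1\ge\varphi_0+1$ and $c_i\ge\varphi_{i-1}(c_1,\ldots,c_{i-1})+1$ for $2\le i\le k$, so that the cylinder is nonempty. It is known that each $P$-cylinder is a half-open interval of the form $(a,b]$. *)

theory Defs
  imports Complex_Main
begin

text \<open>
  A sequence \<open>(\<phi>\<^sub>n)\<close>, with \<open>\<phi>\<^sub>n\<close> a function of \<open>n\<close> positive integers, is encoded as a single
  function on lists: \<open>\<phi>\<^sub>n(c\<^sub>1, \<dots>, c\<^sub>n)\<close> is \<open>\<phi> [c\<^sub>1, \<dots>, c\<^sub>n]\<close>, and the constant \<open>\<phi>\<^sub>0\<close> is \<open>\<phi> []\<close>.
  Its values on lists containing \<open>0\<close> are irrelevant.
\<close>

definition perron_functions :: "(nat list \<Rightarrow> nat) \<Rightarrow> bool" where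
  "perron_functions \<phi> \<longleftrightarrow> (\<forall>cs. (\<forall>c\<in>set cs. 1 \<le> c) \<longrightarrow> 1 \<le> \<phi> cs)"

text \<open>
  Digit sequences are indexed from \<open>1\<close>; the value \<open>p 0\<close> is never used.
\<close>

definition perron_r :: "(nat list \<Rightarrow> nat) \<Rightarrow> (nat \<Rightarrow> nat) \<Rightarrow> nat \<Rightarrow> nat" where
  "perron_r \<phi> p n = \<phi> (map p [1..<Suc n])"

definition perron_term :: "(nat list \<Rightarrow> nat) \<Rightarrow> (nat \<Rightarrow> nat) \<Rightarrow> nat \<Rightarrow> real" where
  "perron_term \<phi> p n =
     (\<Prod>i=0..n. real (perron_r \<phi> p i)) /
     ((\<Prod>i=1..n. (real (p i) - 1) * real (p i)) * real (p (n + 1)))"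

definition P_representation :: "(nat list \<Rightarrow> nat) \<Rightarrow> (nat \<Rightarrow> nat) \<Rightarrow> real \<Rightarrow> bool" where
  "P_representation \<phi> p x \<longleftrightarrow>
     (\<forall>n\<ge>1. 1 \<le> p n \<and> perron_r \<phi> p (n - 1) + 1 \<le> p n) \<and> perron_term \<phi> p sums x"

text \<open>
  The description is on the single digit rather than on the whole sequence \<open>p\<close>, since
  \<open>P_representation\<close> leaves \<open>p 0\<close> undetermined. Only \<open>n \<ge> 1\<close> and \<open>0 < x \<le> 1\<close> are meaningful.
\<close>

definition P_digit :: "(nat list \<Rightarrow> nat) \<Rightarrow> nat \<Rightarrow> real \<Rightarrow> nat" where
  "P_digit \<phi> n x = (THE c. \<exists>p. P_representation \<phi> p x \<and> p n = c)"

definition admissible_base :: "(nat list \<Rightarrow> nat) \<Rightarrow> nat list \<Rightarrow> bool" where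
  "admissible_base \<phi> cs \<longleftrightarrow>
     cs \<noteq> [] \<and> (\<forall>i<length cs. \<phi> (take i cs) + 1 \<le> cs ! i)"

definition P_cylinder :: "(nat list \<Rightarrow> nat) \<Rightarrow> nat list \<Rightarrow> real set" where
  "P_cylinder \<phi> cs = {x \<in> {0<..1}. \<forall>i<length cs. P_digit \<phi> (i + 1) x = cs ! i}"

definition P_cylinder_endpoint :: "(nat list \<Rightarrow> nat) \<Rightarrow> real \<Rightarrow> bool" where
  "P_cylinder_endpoint \<phi> e \<longleftrightarrow>
     (\<exists>cs. admissible_base \<phi> cs \<and> (e = Inf (P_cylinder \<phi> cs) \<or> e = Sup (P_cylinder \<phi> cs)))"

end

theory Submission
  imports Defs
begin

text \<open>
  The whole argument rests on the self-similarity of the expansion. Splitting off the first term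
  gives
  \[ x = \frac{r_0}{p_1} + \frac{r_0}{p_1 (p_1 - 1)}\, y , \]
  where \<open>y\<close> is given by the digits \<open>p\<^sub>2, p\<^sub>3, \<dots>\<close> with respect to the functions obtained from
  \<open>\<phi>\<close> by fixing the first argument to \<open>p\<^sub>1\<close> (lemma \<open>P_representation_step\<close>). Since \<open>y\<close> is in
  \<open>(0, 1]\<close>, the first digit is determined by \<open>r\<^sub>0 / p\<^sub>1 < x \<le> r\<^sub>0 / (p\<^sub>1 - 1)\<close>, and the map from \<open>y\<close>
  to \<open>x\<close> is increasing and contracts by a factor of at least 2, because \<open>p\<^sub>1 \<ge> r\<^sub>0 + 1 \<ge> 2\<close>.
  Inductions on the number of digits, over all \<open>\<phi>\<close> at once, then give everything that is needed:

  \<^item> every \<open>x\<close> in \<open>(0, 1]\<close> has a representation, produced by the greedy choice of digits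
    (\<open>P_representation_greedy\<close>);
  \<^item> a number between two numbers that share their first \<open>m\<close> digits shares these digits too
    (\<open>digits_between\<close>); this says that cylinders are order-convex, and its case of three equal
    numbers is the uniqueness of digits;
  \<^item> two numbers sharing \<open>m\<close> digits have distance at most \<open>2\<^sup>-\<^sup>m\<close> (\<open>dist_le_of_common_digits\<close>).

  The last estimate turns \<open>k\<^sub>n \<rightarrow> \<infinity>\<close> into \<open>x\<^sub>n \<rightarrow> x\<^sub>0\<close>. Conversely, a number
  \<open>x\<^sub>0\<close> that is neither the infimum nor the supremum of its cylinder of rank \<open>m\<close> lies strictly between
  two elements of that order-convex set, so the cylinder is a neighbourhood of \<open>x\<^sub>0\<close>; a sequence that
  converges to \<open>x\<^sub>0\<close> eventually stays in it, that is, \<open>k\<^sub>n > m\<close> eventually.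
\<close>

section \<open>Splitting off the first digit\<close>

definition fix_first :: "(nat list \<Rightarrow> nat) \<Rightarrow> nat \<Rightarrow> nat list \<Rightarrow> nat" where
  "fix_first \<phi> c = (\<lambda>cs. \<phi> (c # cs))"

definition admissible_digits :: "(nat list \<Rightarrow> nat) \<Rightarrow> (nat \<Rightarrow> nat) \<Rightarrow> bool" where
  "admissible_digits \<phi> p \<longleftrightarrow> (\<forall>n. perron_r \<phi> p n + 1 \<le> p (Suc n))"

lemma P_representation_iff:
  "P_representation \<phi> p x \<longleftrightarrow> admissible_digits \<phi> p \<and> perron_term \<phi> p sums x"
proof -
  have "(\<forall>n\<ge>1. 1 \<le> p n \<and> perron_r \<phi> p (n - 1) + 1 \<le> p n)
      \<longleftrightarrow> (\<forall>n. perron_r \<phi> p n + 1 \<le> p (Suc n))"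
    by (metis One_nat_def Suc_le_D add_leD2 diff_Suc_1 le_add1 plus_1_eq_Suc)
  then show ?thesis
    by (simp add: P_representation_def admissible_digits_def)
qed

lemma perron_functions_fix_first:
  "perron_functions \<phi> \<Longrightarrow> 1 \<le> c \<Longrightarrow> perron_functions (fix_first \<phi> c)"
  by (simp add: perron_functions_def fix_first_def)

lemma perron_functions_Nil: "perron_functions \<phi> \<Longrightarrow> 1 \<le> \<phi> []"
  by (simp add: perron_functions_def)

lemma perron_r_0: "perron_r \<phi> p 0 = \<phi> []"
  by (simp add: perron_r_def)

lemma perron_r_Suc:
  "perron_r \<phi> p (Suc n) = perron_r (fix_first \<phi> (p 1)) (\<lambda>i. p (Suc i)) n"
proof -
  have "[1..<Suc (Suc n)] = 1 # map Suc [1..<Suc n]"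
    by (simp add: upt_conv_Cons map_Suc_upt del: upt_Suc)
  then show ?thesis
    by (simp add: perron_r_def fix_first_def comp_def del: upt_Suc)
qed

lemma admissible_digits_first:
  assumes "admissible_digits \<phi> p"
  shows "\<phi> [] + 1 \<le> p 1"
  using assms unfolding admissible_digits_def by (metis One_nat_def perron_r_0)

lemma admissible_digits_shift:
  assumes "admissible_digits \<phi> p"
  shows "admissible_digits (fix_first \<phi> (p 1)) (\<lambda>i. p (Suc i))"
  using assms unfolding admissible_digits_def by (metis perron_r_Suc)

lemma perron_term_0: "perron_term \<phi> p 0 = real (\<phi> []) / real (p 1)"
  by (simp add: perron_term_def perron_r_0)

lemma perron_term_Suc:
  "perron_term \<phi> p (Suc n) =
     real (\<phi> []) / (real (p 1) * (real (p 1) - 1)) *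
       perron_term (fix_first \<phi> (p 1)) (\<lambda>i. p (Suc i)) n"
proof -
  have "(\<Prod>i=0..Suc n. real (perron_r \<phi> p i)) =
      real (\<phi> []) * (\<Prod>i=0..n. real (perron_r (fix_first \<phi> (p 1)) (\<lambda>i. p (Suc i)) i))"
    by (simp only: prod.atLeast0_atMost_Suc_shift comp_def perron_r_Suc perron_r_0)
  moreover have "(\<Prod>i=1..Suc n. (real (p i) - 1) * real (p i)) =
      (real (p 1) - 1) * real (p 1) * (\<Prod>i=1..n. (real (p (Suc i)) - 1) * real (p (Suc i)))"
    by (subst prod.atLeast_Suc_atMost) (simp_all add: prod.shift_bounds_cl_Suc_ivl del: prod.cl_ivl_Suc)
  ultimately show ?thesis
    by (simp add: perron_term_def mult.commute mult.left_commute)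
qed

lemma perron_term_nonneg:
  assumes "admissible_digits \<phi> p"
  shows "0 \<le> perron_term \<phi> p n"
proof -
  have "1 \<le> p i" if "1 \<le> i" for i
    using assms that unfolding admissible_digits_def
    by (metis One_nat_def Suc_le_D add_leD2)
  then show ?thesis
    unfolding perron_term_def
    by (intro divide_nonneg_nonneg mult_nonneg_nonneg prod_nonneg) auto
qed

text \<open>
  If the tail has partial sums at most 1, then adding the first term gives at most
  \<open>r\<^sub>0 / p\<^sub>1 + r\<^sub>0 / (p\<^sub>1 (p\<^sub>1 - 1)) = r\<^sub>0 / (p\<^sub>1 - 1) \<le> 1\<close>.
\<close>

lemma perron_partial_sum_le_1:
  assumes "admissible_digits \<phi> p" "perron_functions \<phi>"
  shows "(\<Sum>i<n. perron_term \<phi> p i) \<le> 1"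
  using assms
proof (induction n arbitrary: \<phi> p)
  case 0
  then show ?case by simp
next
  case (Suc n)
  define r c where "r = real (\<phi> [])" and "c = real (p 1)"
  have rc: "1 \<le> r" "r + 1 \<le> c"
    using admissible_digits_first[OF Suc.prems(1)] perron_functions_Nil[OF Suc.prems(2)]
    by (simp_all add: r_def c_def)
  let ?T = "\<Sum>i<n. perron_term (fix_first \<phi> (p 1)) (\<lambda>i. p (Suc i)) i"
  have "?T \<le> 1"
    using Suc.prems rc
    by (intro Suc.IH admissible_digits_shift perron_functions_fix_first) (simp_all add: c_def)
  then have "r / (c * (c - 1)) * ?T \<le> r / (c * (c - 1)) * 1"
    using rc by (intro mult_left_mono) simp_all
  moreover have "(\<Sum>i<Suc n. perron_term \<phi> p i) = r / c + r / (c * (c - 1)) * ?T"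
    by (simp add: sum.lessThan_Suc_shift perron_term_0 perron_term_Suc sum_distrib_left r_def c_def
        del: sum.lessThan_Suc)
  moreover have "r / c + r / (c * (c - 1)) * 1 = r / (c - 1)"
    using rc by (simp add: field_simps)
  moreover have "r / (c - 1) \<le> 1"
    using rc by simp
  ultimately show ?case by linarith
qed

lemma P_representation_bounds:
  assumes "P_representation \<phi> p x" "perron_functions \<phi>"
  shows "0 < x" "x \<le> 1"
proof -
  have adm: "admissible_digits \<phi> p" and sums: "perron_term \<phi> p sums x"
    using assms(1) by (simp_all add: P_representation_iff)
  show "x \<le> 1"
    using sums perron_partial_sum_le_1[OF adm assms(2)] unfolding sums_def
    by (intro LIMSEQ_le_const2) auto
  have "(\<Sum>i<Suc 0. perron_term \<phi> p i) \<le> x"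
    using sums perron_term_nonneg[OF adm] by (metis sum_le_suminf sums_iff finite_lessThan)
  moreover have "0 < perron_term \<phi> p 0"
    using admissible_digits_first[OF adm] perron_functions_Nil[OF assms(2)]
    by (simp add: perron_term_0)
  ultimately show "0 < x" by simp
qed

lemma P_representation_step:
  assumes "P_representation \<phi> p x" "perron_functions \<phi>"
  obtains y where "P_representation (fix_first \<phi> (p 1)) (\<lambda>i. p (Suc i)) y"
    "perron_functions (fix_first \<phi> (p 1))" "1 \<le> \<phi> []" "\<phi> [] + 1 \<le> p 1" "0 < y" "y \<le> 1"
    "x = real (\<phi> []) / real (p 1) + real (\<phi> []) / (real (p 1) * (real (p 1) - 1)) * y"
proof -
  define r c where "r = real (\<phi> [])" and "c = real (p 1)"
  define y where "y = (x - r / c) / (r / (c * (c - 1)))"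
  have adm: "admissible_digits \<phi> p" and sums: "perron_term \<phi> p sums x"
    using assms(1) by (simp_all add: P_representation_iff)
  have le: "1 \<le> \<phi> []" "\<phi> [] + 1 \<le> p 1"
    using admissible_digits_first[OF adm] perron_functions_Nil[OF assms(2)] by simp_all
  then have rc: "1 \<le> r" "r + 1 \<le> c" by (simp_all add: r_def c_def)
  have pf: "perron_functions (fix_first \<phi> (p 1))"
    using assms(2) le by (intro perron_functions_fix_first) simp_all
  have "(\<lambda>n. perron_term \<phi> p (Suc n)) sums (x - r / c)"
    using sums by (simp add: sums_Suc_iff perron_term_0 r_def c_def)
  then have "(\<lambda>n. r / (c * (c - 1)) * perron_term (fix_first \<phi> (p 1)) (\<lambda>i. p (Suc i)) n)
      sums (x - r / c)"
    by (simp add: perron_term_Suc r_def c_def)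
  then have "(\<lambda>n. r / (c * (c - 1)) * perron_term (fix_first \<phi> (p 1)) (\<lambda>i. p (Suc i)) n
      / (r / (c * (c - 1)))) sums y"
    unfolding y_def by (rule sums_divide)
  then have "perron_term (fix_first \<phi> (p 1)) (\<lambda>i. p (Suc i)) sums y"
    using rc by simp
  then have rep: "P_representation (fix_first \<phi> (p 1)) (\<lambda>i. p (Suc i)) y"
    using admissible_digits_shift[OF adm] by (simp add: P_representation_iff)
  have "x = r / c + r / (c * (c - 1)) * y"
    using rc by (simp add: y_def)
  then show thesis
    using that[OF rep pf le P_representation_bounds[OF rep pf]] by (simp add: r_def c_def)
qed

text \<open>
  These are the values of the affine map of \<open>P_representation_step\<close> at the ends 0 and 1 of the range
  of \<open>y\<close>. For different \<open>p\<^sub>1\<close> the resulting intervals are disjoint and lie in decreasing order.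
\<close>

lemma first_digit_bounds:
  assumes "P_representation \<phi> p x" "perron_functions \<phi>"
  shows "real (\<phi> []) / real (p 1) < x" "x \<le> real (\<phi> []) / (real (p 1) - 1)"
proof -
  define r c where "r = real (\<phi> [])" and "c = real (p 1)"
  obtain y where y: "0 < y" "y \<le> 1" "x = r / c + r / (c * (c - 1)) * y"
    and "1 \<le> \<phi> []" "\<phi> [] + 1 \<le> p 1"
    using P_representation_step[OF assms] unfolding r_def c_def by metis
  then have rc: "1 \<le> r" "r + 1 \<le> c"
    by (simp_all add: r_def c_def)
  have "0 < r / (c * (c - 1))" using rc by simp
  then have "0 < r / (c * (c - 1)) * y" "r / (c * (c - 1)) * y \<le> r / (c * (c - 1)) * 1"
    using y by (simp_all only: zero_less_mult_iff mult_le_cancel_left_pos simp_thms)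
  moreover have "r / c + r / (c * (c - 1)) * 1 = r / (c - 1)"
    using rc by (simp add: field_simps)
  ultimately show "real (\<phi> []) / real (p 1) < x" "x \<le> real (\<phi> []) / (real (p 1) - 1)"
    using y(3) unfolding r_def[symmetric] c_def[symmetric] by linarith+
qed

section \<open>Existence of the representation\<close>

text \<open>
  This is the integer \<open>c\<close> with \<open>r / c < x \<le> r / (c - 1)\<close>, the only candidate for a first digit
  by \<open>first_digit_bounds\<close>.
\<close>

definition greedy_digit :: "nat \<Rightarrow> real \<Rightarrow> nat" where
  "greedy_digit r x = nat \<lfloor>real r / x\<rfloor> + 1"

definition greedy_rest :: "nat \<Rightarrow> real \<Rightarrow> real" where
  "greedy_rest r x = (let c = real (greedy_digit r x) in (x - r / c) / (r / (c * (c - 1))))"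

text \<open>
  Digits start at index 1, and \<open>d\<close> is the entry at index 0. With this entry as a parameter, the
  sequence shifted by one position is literally a greedy sequence again, namely the one whose entry
  at index 0 is the first digit; so the recursion of \<open>perron_term\<close> applies to it directly.
\<close>

primrec greedy :: "nat \<Rightarrow> (nat list \<Rightarrow> nat) \<Rightarrow> real \<Rightarrow> nat \<Rightarrow> nat" where
  "greedy 0 \<phi> x d = d"
| "greedy (Suc n) \<phi> x d =
     greedy n (fix_first \<phi> (greedy_digit (\<phi> []) x)) (greedy_rest (\<phi> []) x)
       (greedy_digit (\<phi> []) x)"

lemma greedy_step:
  assumes "1 \<le> r" "0 < x" "x \<le> 1"
  shows "r + 1 \<le> greedy_digit r x" "0 < greedy_rest r x" "greedy_rest r x \<le> 1"
    "x = real r / greedy_digit r x +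
       real r / (real (greedy_digit r x) * (real (greedy_digit r x) - 1)) * greedy_rest r x"
proof -
  define c where "c = real (greedy_digit r x)"
  have "real r \<le> real r / x"
    using assms by (simp add: field_simps)
  then have fl: "int r \<le> \<lfloor>real r / x\<rfloor>"
    by (simp add: le_floor_iff)
  then show le: "r + 1 \<le> greedy_digit r x"
    by (simp add: greedy_digit_def)
  have c: "c = real_of_int \<lfloor>real r / x\<rfloor> + 1"
    using fl by (simp add: c_def greedy_digit_def)
  have rc: "1 \<le> real r" "real r + 1 \<le> c"
    using le assms(1) by (simp_all add: c_def)
  have "real r / x < c" "c - 1 \<le> real r / x"
    unfolding c by linarith+
  then have lo: "real r < x * c" and hi: "x * (c - 1) \<le> real r"
    using assms(2) by (simp_all add: field_simps)
  have rest: "greedy_rest r x = (x * c - r) * (c - 1) / r"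
    using rc by (simp add: greedy_rest_def c_def[symmetric] Let_def field_simps)
  show "0 < greedy_rest r x"
    unfolding rest using rc lo by simp
  have "c * (x * (c - 1)) \<le> c * r"
    using hi rc by (intro mult_left_mono) simp_all
  then show "greedy_rest r x \<le> 1"
    unfolding rest using rc by (simp add: field_simps)
  show "x = real r / greedy_digit r x +
       real r / (real (greedy_digit r x) * (real (greedy_digit r x) - 1)) * greedy_rest r x"
    unfolding c_def[symmetric] greedy_rest_def Let_def using rc by simp
qed

lemma greedy_admissible:
  assumes "perron_functions \<phi>" "0 < x" "x \<le> 1"
  shows "perron_r \<phi> (\<lambda>i. greedy i \<phi> x d) n + 1 \<le> greedy (Suc n) \<phi> x d"
  using assms
proof (induction n arbitrary: \<phi> x d)
  case 0
  then show ?case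
    using greedy_step(1)[OF perron_functions_Nil] by (simp add: perron_r_0)
next
  case (Suc n)
  note step = greedy_step[OF perron_functions_Nil[OF Suc.prems(1)] Suc.prems(2,3)]
  have "perron_functions (fix_first \<phi> (greedy_digit (\<phi> []) x))"
    using Suc.prems(1) step(1) by (intro perron_functions_fix_first) simp_all
  from Suc.IH[OF this step(2,3)] show ?case
    by (simp add: perron_r_Suc)
qed

text \<open>
  The slope of the affine map that recovers a number from its tail: since \<open>c - 1 \<ge> r\<close>, it is at most
  \<open>1 / c\<close>, and \<open>c \<ge> 2\<close>.
\<close>

lemma contraction_factor:
  fixes r c :: real
  assumes "1 \<le> r" "r + 1 \<le> c"
  shows "0 < r / (c * (c - 1))" "r / (c * (c - 1)) \<le> 1 / 2"
proof -
  show "0 < r / (c * (c - 1))" using assms by simp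
  have "2 * r \<le> c * (c - 1)"
    using assms by (intro mult_mono) simp_all
  then show "r / (c * (c - 1)) \<le> 1 / 2"
    using assms by (simp add: field_simps)
qed

text \<open>
  A partial sum arises from a partial sum of the tail by the same affine map by which \<open>x\<close> arises
  from its greedy rest, so each further term at least halves the worst-case error.
\<close>

lemma greedy_error:
  assumes "perron_functions \<phi>" "0 < x" "x \<le> 1"
  shows "\<bar>(\<Sum>i<n. perron_term \<phi> (\<lambda>i. greedy i \<phi> x d) i) - x\<bar> \<le> (1 / 2) ^ n"
  using assms
proof (induction n arbitrary: \<phi> x d)
  case 0
  then show ?case by simp
next
  case (Suc n)
  note step = greedy_step[OF perron_functions_Nil[OF Suc.prems(1)] Suc.prems(2,3)]
  let ?c = "greedy_digit (\<phi> []) x" and ?y = "greedy_rest (\<phi> []) x"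
  define q where "q = real (\<phi> []) / (real ?c * (real ?c - 1))"
  define S where "S = (\<Sum>i<n. perron_term (fix_first \<phi> ?c) (\<lambda>i. greedy i (fix_first \<phi> ?c) ?y ?c) i)"
  have "perron_functions (fix_first \<phi> ?c)"
    using Suc.prems(1) step(1) by (intro perron_functions_fix_first) simp_all
  from Suc.IH[OF this step(2,3)] have IH: "\<bar>S - ?y\<bar> \<le> (1 / 2) ^ n"
    by (simp add: S_def)
  have q: "0 < q" "q \<le> 1 / 2"
    using contraction_factor[of "real (\<phi> [])" "real ?c"] step(1) perron_functions_Nil[OF Suc.prems(1)]
    by (simp_all add: q_def)
  have "(\<Sum>i<Suc n. perron_term \<phi> (\<lambda>i. greedy i \<phi> x d) i) = real (\<phi> []) / real ?c + q * S"
    by (simp add: sum.lessThan_Suc_shift perron_term_0 perron_term_Suc sum_distrib_left q_def S_def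
        del: sum.lessThan_Suc)
  moreover have "x = real (\<phi> []) / real ?c + q * ?y"
    using step(4) by (simp add: q_def)
  ultimately have "\<bar>(\<Sum>i<Suc n. perron_term \<phi> (\<lambda>i. greedy i \<phi> x d) i) - x\<bar> = \<bar>q * (S - ?y)\<bar>"
    by (simp add: right_diff_distrib)
  also have "\<dots> = q * \<bar>S - ?y\<bar>"
    using q by (simp add: abs_mult)
  also have "\<dots> \<le> 1 / 2 * (1 / 2) ^ n"
    using q IH by (intro mult_mono) simp_all
  finally show ?case by simp
qed

lemma P_representation_greedy:
  assumes "perron_functions \<phi>" "0 < x" "x \<le> 1"
  shows "P_representation \<phi> (\<lambda>i. greedy i \<phi> x d) x"
proof -
  have "(\<lambda>n. (1 / 2 :: real) ^ n) \<longlonglongrightarrow> 0"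
    by (rule LIMSEQ_power_zero) simp
  then have "perron_term \<phi> (\<lambda>i. greedy i \<phi> x d) sums x"
    unfolding sums_def
    by (rule metric_tendsto_imp_tendsto) (simp add: dist_real_def greedy_error[OF assms])
  then show ?thesis
    using greedy_admissible[OF assms] by (simp add: P_representation_iff admissible_digits_def)
qed

section \<open>Common digits, order and distance\<close>

text \<open>
  The first digit is a monotone function of the number, by \<open>first_digit_bounds\<close>, and the tails of
  three numbers with the same first digit are ordered like the numbers themselves.
\<close>

lemma digits_between:
  assumes "perron_functions \<phi>"
    and "P_representation \<phi> p a" "P_representation \<phi> q y" "P_representation \<phi> s b"
    and "a \<le> y" "y \<le> b" "\<And>i. 1 \<le> i \<Longrightarrow> i \<le> m \<Longrightarrow> p i = s i"
    and "1 \<le> i" "i \<le> m"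
  shows "q i = p i"
  using assms
proof (induction m arbitrary: \<phi> p q s a y b i)
  case 0
  then show ?case by simp
next
  case (Suc m)
  define r c d where "r = real (\<phi> [])" and "c = real (p 1)" and "d = real (q 1)"
  have ps: "s 1 = p 1" using Suc.prems(7)[of 1] by simp
  obtain a' where a': "P_representation (fix_first \<phi> (p 1)) (\<lambda>i. p (Suc i)) a'"
    and pf: "perron_functions (fix_first \<phi> (p 1))"
    and le: "1 \<le> \<phi> []" "\<phi> [] + 1 \<le> p 1"
    and eqa: "a = r / c + r / (c * (c - 1)) * a'"
    using P_representation_step[OF Suc.prems(2,1)] unfolding r_def c_def by metis
  obtain y' where y': "P_representation (fix_first \<phi> (q 1)) (\<lambda>i. q (Suc i)) y'"
    and le': "\<phi> [] + 1 \<le> q 1"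
    and eqy: "y = r / d + r / (d * (d - 1)) * y'"
    using P_representation_step[OF Suc.prems(3,1)] unfolding r_def d_def by metis
  obtain b' where b': "P_representation (fix_first \<phi> (p 1)) (\<lambda>i. s (Suc i)) b'"
    and eqb: "b = r / c + r / (c * (c - 1)) * b'"
    using P_representation_step[OF Suc.prems(4,1)] unfolding r_def c_def ps by metis
  have rcd: "1 \<le> r" "r + 1 \<le> c" "r + 1 \<le> d"
    using le le' by (simp_all add: r_def c_def d_def)
  have "r / c < r / (d - 1)"
    using first_digit_bounds[OF Suc.prems(2,1)] first_digit_bounds[OF Suc.prems(3,1)] Suc.prems(5)
    unfolding r_def c_def d_def by linarith
  then have "r * (d - 1) < r * c"
    using rcd by (simp add: divide_less_eq less_divide_eq mult.commute)
  then have "d - 1 < c"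
    using rcd by simp
  moreover have "r / d < r / (c - 1)"
    using first_digit_bounds[OF Suc.prems(3,1)] first_digit_bounds[OF Suc.prems(4,1)] Suc.prems(6)
    unfolding r_def c_def d_def ps by linarith
  then have "r * (c - 1) < r * d"
    using rcd by (simp add: divide_less_eq less_divide_eq mult.commute)
  then have "c - 1 < d"
    using rcd by simp
  ultimately have qp: "q 1 = p 1"
    unfolding c_def d_def by linarith
  then have dc: "d = c" by (simp add: c_def d_def)
  have pos: "0 < r / (c * (c - 1))" using rcd by simp
  have "a' \<le> y'" "y' \<le> b'"
    using Suc.prems(5,6) pos unfolding eqa eqy eqb dc
    by (simp_all only: add_le_cancel_left mult_le_cancel_left_pos)
  moreover have "p (Suc j) = s (Suc j)" if "1 \<le> j" "j \<le> m" for j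
    using Suc.prems(7)[of "Suc j"] that by simp
  ultimately have IH: "q (Suc j) = p (Suc j)" if "1 \<le> j" "j \<le> m" for j
    using Suc.IH[OF pf a' y'[unfolded qp] b'] that by blast
  show ?case
  proof (cases "i = 1")
    case True
    then show ?thesis using qp by simp
  next
    case False
    then show ?thesis using IH[of "i - 1"] Suc.prems(8,9) by simp
  qed
qed

text \<open>
  Numbers with the same first digit arise from their tails by the same contraction; after \<open>m\<close> steps
  what is left are two tails in \<open>(0, 1]\<close>.
\<close>

lemma dist_le_of_common_digits:
  assumes "perron_functions \<phi>" "P_representation \<phi> p x" "P_representation \<phi> q y"
    and "\<And>i. 1 \<le> i \<Longrightarrow> i \<le> m \<Longrightarrow> p i = q i"
  shows "\<bar>x - y\<bar> \<le> (1 / 2) ^ m"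
  using assms
proof (induction m arbitrary: \<phi> p q x y)
  case 0
  then show ?case
    using P_representation_bounds[of \<phi> p x] P_representation_bounds[of \<phi> q y] by simp
next
  case (Suc m)
  have pq: "q 1 = p 1" using Suc.prems(4)[of 1] by simp
  define t where "t = real (\<phi> []) / (real (p 1) * (real (p 1) - 1))"
  obtain x' where x': "P_representation (fix_first \<phi> (p 1)) (\<lambda>i. p (Suc i)) x'"
    and pf: "perron_functions (fix_first \<phi> (p 1))"
    and le: "1 \<le> \<phi> []" "\<phi> [] + 1 \<le> p 1"
    and eqx: "x = real (\<phi> []) / real (p 1) + t * x'"
    using P_representation_step[OF Suc.prems(2,1)] unfolding t_def by metis
  obtain y' where y': "P_representation (fix_first \<phi> (p 1)) (\<lambda>i. q (Suc i)) y'"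
    and eqy: "y = real (\<phi> []) / real (p 1) + t * y'"
    using P_representation_step[OF Suc.prems(3,1)] unfolding t_def pq by metis
  have t: "0 < t" "t \<le> 1 / 2"
    using contraction_factor[of "real (\<phi> [])" "real (p 1)"] le by (simp_all add: t_def)
  have IH: "\<bar>x' - y'\<bar> \<le> (1 / 2) ^ m"
    using Suc.IH[OF pf x' y'] Suc.prems(4) by simp
  have "\<bar>x - y\<bar> = \<bar>t * (x' - y')\<bar>"
    unfolding eqx eqy by (simp add: right_diff_distrib)
  also have "\<dots> = t * \<bar>x' - y'\<bar>"
    using t by (simp add: abs_mult)
  also have "\<dots> \<le> 1 / 2 * (1 / 2) ^ m"
    using t IH by (intro mult_mono) simp_all
  finally show ?case by simp
qed

section \<open>Digits and cylinders\<close>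

lemma P_digit_eq:
  assumes "perron_functions \<phi>" "P_representation \<phi> p x" "1 \<le> n"
  shows "P_digit \<phi> n x = p n"
  unfolding P_digit_def
proof (rule the_equality)
  show "\<exists>q. P_representation \<phi> q x \<and> q n = p n"
    using assms(2) by blast
next
  fix c
  assume "\<exists>q. P_representation \<phi> q x \<and> q n = c"
  then show "c = p n"
    using digits_between[OF assms(1,2) _ assms(2) order_refl order_refl refl assms(3) order_refl]
    by blast
qed

lemma P_representation_P_digit:
  assumes "perron_functions \<phi>" "x \<in> {0<..1}"
  shows "P_representation \<phi> (\<lambda>n. P_digit \<phi> n x) x"
proof -
  \<comment> \<open>Starting the greedy sequence with the unspecified value of the digit of index 0 makes the two
    sequences equal everywhere.\<close>
  define p where "p = (\<lambda>i. greedy i \<phi> x (P_digit \<phi> 0 x))"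
  have rep: "P_representation \<phi> p x"
    unfolding p_def using assms by (intro P_representation_greedy) simp_all
  have "P_digit \<phi> n x = p n" for n
  proof (cases n)
    case 0
    then show ?thesis by (simp add: p_def)
  next
    case (Suc k)
    then show ?thesis using P_digit_eq[OF assms(1) rep] by simp
  qed
  then show ?thesis using rep by simp
qed

lemma P_cylinder_mem_iff:
  "y \<in> P_cylinder \<phi> (map (\<lambda>i. P_digit \<phi> i x) [1..<Suc m]) \<longleftrightarrow>
     y \<in> {0<..1} \<and> (\<forall>i. 1 \<le> i \<and> i \<le> m \<longrightarrow> P_digit \<phi> i y = P_digit \<phi> i x)"
proof -
  have "(\<forall>i<m. P_digit \<phi> (Suc i) y = P_digit \<phi> (Suc i) x) \<longleftrightarrow>
      (\<forall>i. 1 \<le> i \<and> i \<le> m \<longrightarrow> P_digit \<phi> i y = P_digit \<phi> i x)"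
    by (metis One_nat_def Suc_le_D Suc_le_eq le_add1 plus_1_eq_Suc)
  then show ?thesis
    by (simp add: P_cylinder_def del: upt_Suc)
qed

lemma admissible_base_P_digit:
  assumes "perron_functions \<phi>" "x \<in> {0<..1}" "1 \<le> m"
  shows "admissible_base \<phi> (map (\<lambda>i. P_digit \<phi> i x) [1..<Suc m])"
proof -
  have "\<phi> (map (\<lambda>i. P_digit \<phi> i x) [1..<Suc i]) + 1 \<le> P_digit \<phi> (Suc i) x" for i
    using P_representation_P_digit[OF assms(1,2)]
    unfolding P_representation_iff admissible_digits_def perron_r_def by blast
  then show ?thesis
    using assms(3) by (auto simp: admissible_base_def take_map take_upt simp del: upt_Suc)
qed

text \<open>
  A number that is neither the infimum nor the supremum of a bounded set containing it lies strictly
  between two elements of the set. For a cylinder, the whole interval between these two elements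
  belongs to the set by \<open>digits_between\<close>.
\<close>

lemma eventually_common_digits:
  assumes "perron_functions \<phi>" "x0 \<in> {0<..1}" "\<not> P_cylinder_endpoint \<phi> x0" "1 \<le> m"
  shows "\<forall>\<^sub>F y in nhds x0. \<forall>i. 1 \<le> i \<and> i \<le> m \<longrightarrow> P_digit \<phi> i y = P_digit \<phi> i x0"
proof -
  define C where "C = P_cylinder \<phi> (map (\<lambda>i. P_digit \<phi> i x0) [1..<Suc m])"
  have mem: "x0 \<in> C"
    using assms(2) by (simp only: C_def P_cylinder_mem_iff) simp
  have ne: "x0 \<noteq> Inf C" "x0 \<noteq> Sup C"
    using assms(3) admissible_base_P_digit[OF assms(1,2,4)]
    unfolding C_def P_cylinder_endpoint_def by blast+
  have sub: "C \<subseteq> {0<..1}"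
    unfolding C_def P_cylinder_def by blast
  then have "bdd_below C" "bdd_above C"
    by (meson bdd_below_mono bdd_below_Ioc, meson bdd_above_mono bdd_above_Ioc)
  then have "Inf C < x0" "x0 < Sup C"
    using cInf_lower[OF mem] cSup_upper[OF mem] ne by simp_all
  then obtain a b where a: "a \<in> C" "a < x0" and b: "b \<in> C" "x0 < b"
    using cInf_lessD[of C x0] less_cSupD[of C x0] mem by blast
  have "P_digit \<phi> i y = P_digit \<phi> i x0" if y: "y \<in> {a<..<b}" and i: "1 \<le> i" "i \<le> m" for y i
  proof -
    have ab: "a \<in> {0<..1}" "b \<in> {0<..1}" using a b sub by blast+
    then have y01: "y \<in> {0<..1}" using y by simp
    have dig: "P_digit \<phi> j a = P_digit \<phi> j x0" "P_digit \<phi> j b = P_digit \<phi> j x0"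
      if "1 \<le> j" "j \<le> m" for j
      using a(1) b(1) that unfolding C_def P_cylinder_mem_iff by blast+
    have "P_digit \<phi> i y = P_digit \<phi> i a"
      by (rule digits_between[OF assms(1) P_representation_P_digit[OF assms(1) ab(1)]
            P_representation_P_digit[OF assms(1) y01] P_representation_P_digit[OF assms(1) ab(2)]
            _ _ _ i]) (use y dig in simp_all)
    then show ?thesis using dig i by simp
  qed
  moreover have "\<forall>\<^sub>F y in nhds x0. y \<in> {a<..<b}"
    using a b by (intro eventually_nhds_in_open) simp_all
  ultimately show ?thesis
    by (auto elim: eventually_mono)
qed

theorem proposition2:
  fixes \<phi> :: "nat list \<Rightarrow> nat" and x0 :: real and x :: "nat \<Rightarrow> real" and k :: "nat \<Rightarrow> nat"
  assumes "perron_functions \<phi>"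
    and "x0 \<in> {0<..1}"
    and "\<And>n. 1 \<le> n \<Longrightarrow> x n \<in> {0<..1} - {x0}"
    and "\<And>n. 1 \<le> n \<Longrightarrow> k n = (LEAST j. 1 \<le> j \<and> P_digit \<phi> j (x n) \<noteq> P_digit \<phi> j x0)"
    and "\<not> P_cylinder_endpoint \<phi> x0"
  shows "x \<longlonglongrightarrow> x0 \<longleftrightarrow> filterlim k at_top sequentially"
proof -
  have dist: "\<bar>y - x0\<bar> \<le> (1 / 2) ^ m"
    if "y \<in> {0<..1}" "\<And>i. 1 \<le> i \<Longrightarrow> i \<le> m \<Longrightarrow> P_digit \<phi> i y = P_digit \<phi> i x0" for y m
    using dist_le_of_common_digits[OF assms(1) P_representation_P_digit[OF assms(1) that(1)]
        P_representation_P_digit[OF assms(1,2)]] that(2) by blast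
  have pow0: "(\<lambda>m. (1 / 2 :: real) ^ m) \<longlonglongrightarrow> 0"
    by (rule LIMSEQ_power_zero) simp
  \<comment> \<open>The least index in the definition of \<open>k n\<close> exists, since numbers with the same digits have
    distance at most \<open>2\<^sup>-\<^sup>m\<close> for every \<open>m\<close>.\<close>
  have ex: "\<exists>j. 1 \<le> j \<and> P_digit \<phi> j (x n) \<noteq> P_digit \<phi> j x0" if n: "1 \<le> n" for n
  proof (rule ccontr)
    assume "\<not> ?thesis"
    then have "\<bar>x n - x0\<bar> \<le> (1 / 2) ^ m" for m
      using dist assms(3)[OF n] by blast
    then have "\<bar>x n - x0\<bar> \<le> 0"
      by (intro LIMSEQ_le_const[OF pow0]) auto
    then show False using assms(3)[OF n] by simp
  qed
  have k_gt_iff: "m < k n \<longleftrightarrow> (\<forall>i. 1 \<le> i \<and> i \<le> m \<longrightarrow> P_digit \<phi> i (x n) = P_digit \<phi> i x0)"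
    if n: "1 \<le> n" for n m
  proof
    assume "m < k n"
    then show "\<forall>i. 1 \<le> i \<and> i \<le> m \<longrightarrow> P_digit \<phi> i (x n) = P_digit \<phi> i x0"
      using not_less_Least le_less_trans unfolding assms(4)[OF n] by blast
  next
    assume "\<forall>i. 1 \<le> i \<and> i \<le> m \<longrightarrow> P_digit \<phi> i (x n) = P_digit \<phi> i x0"
    then show "m < k n"
      using LeastI_ex[OF ex[OF n]] unfolding assms(4)[OF n] by (meson not_le)
  qed
  show ?thesis
  proof
    assume lim: "x \<longlonglongrightarrow> x0"
    show "filterlim k at_top sequentially"
      unfolding filterlim_at_top
    proof
      fix Z
      \<comment> \<open>Rank \<open>Suc Z\<close>, because cylinders have positive rank.\<close>
      have "\<forall>\<^sub>F n in sequentially. \<forall>i. 1 \<le> i \<and> i \<le> Suc Z \<longrightarrow> P_digit \<phi> i (x n) = P_digit \<phi> i x0"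
        using eventually_common_digits[OF assms(1,2,5), of "Suc Z"] lim
        unfolding filterlim_iff by (elim allE impE) simp_all
      then show "\<forall>\<^sub>F n in sequentially. Z \<le> k n"
        using eventually_ge_at_top[of 1]
      proof eventually_elim
        case (elim n)
        then have "Suc Z < k n" using k_gt_iff by blast
        then show ?case by simp
      qed
    qed
  next
    assume lim: "filterlim k at_top sequentially"
    have "filterlim (\<lambda>n. k n - 1) sequentially sequentially"
      using lim by (intro filterlim_compose[OF filterlim_minus_const_nat_at_top])
    then have "(\<lambda>n. (1 / 2 :: real) ^ (k n - 1)) \<longlonglongrightarrow> 0"
      by (rule filterlim_compose[OF pow0])
    then show "x \<longlonglongrightarrow> x0"
    proof (rule metric_tendsto_imp_tendsto)
      show "\<forall>\<^sub>F n in sequentially. dist (x n) x0 \<le> dist ((1 / 2) ^ (k n - 1)) (0 :: real)"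
        using eventually_ge_at_top[of 1]
      proof eventually_elim
        case (elim n)
        have "0 < k n" using k_gt_iff[OF elim, of 0] by simp
        then have "k n - 1 < k n" by simp
        then show ?case
          using dist[of "x n" "k n - 1"] k_gt_iff[OF elim] assms(3)[OF elim]
          by (simp add: dist_real_def)
      qed
    qed
  qed
qed

end
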